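(* Let $\mathbf{P}=(P;\wedge_p,\vee_p,\neg_p,\bot_p,\top_p)$ and $\mathbf{Q}=(Q;\wedge_q,\vee_q,\neg_q,\bot_q,\top_q)$ be Boolean algebras (whose underlying sets $P,Q$ need not be disjoint) such that $\{\top_p,\bot_q\}\subseteq P\cap Q$. Define $r:P\cup Q\to P$ by $r(x)=x$ if $x\in P$ and $r(x)=\top_p$ otherwise; $r':P\cup Q\to Q$ by $r'(x)=x$ if $x\in Q$ and $r'(x)=\bot_q$ otherwise; and $e:P\to P\cup Q$, $e':Q\to P\cup Q$ the inclusion maps. Let $\mathbf{P}+\mathbf{Q}=(P\cup Q;\sqcap,\sqcup,\neg,\lrcorner,e'(\top_q),e(\bot_p))$ with $x\sqcap y:=e(r(x)\wedge_p r(y))$, $x\sqcup y:=e'(r'(x)\vee_q r'(y))$, $\neg x:=e(\neg_p r(x))$, $\lrcorner x:=e'(\neg_q r'(x))$. Then $\mathbf{P}+\mathbf{Q}$ is a generalized D-core algebra.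
   Context: For an algebra $(D;\sqcap,\sqcup,\neg,\lrcorner,\top,\bot)$ of type $(2,2,1,1,0,0)$ write $x\vee y:=\neg(\neg x\sqcap\neg y)$ and $x\wedge y:=\lrcorner(\lrcorner x\sqcup\lrcorner y)$. A generalized D-core algebra is such an algebra satisfying, for all $x,y,z$: $x\sqcap y=y\sqcap x$; $x\sqcup y=y\sqcup x$; $\neg(x\sqcap x)=\neg x$; $\lrcorner(x\sqcup x)=\lrcorner x$; $x\sqcap(y\vee z)=(x\sqcap y)\vee(x\sqcap z)$; $x\sqcup(y\wedge z)=(x\sqcup y)\wedge(x\sqcup z)$; $\neg\neg(x\sqcap y)=x\sqcap y$; $\lrcorner\lrcorner(x\sqcup y)=x\sqcup y$; $x\sqcap\neg x=\bot$; $x\sqcup\lrcorner x=\top$; $(x\sqcap x)\sqcup(x\sqcap x)=(x\sqcup x)\sqcap(x\sqcup x)$. *)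

theory Defs
  imports "HOL-Algebra.Congruence"
begin

text \<open>
  All structures are records over an explicit carrier, so that two Boolean algebras may live in one
  ambient type with overlapping carriers.  The operations are total functions on the ambient type;
  only their values on the carrier matter.
\<close>

record 'a ba = "'a partial_object" +
  meet :: "'a \<Rightarrow> 'a \<Rightarrow> 'a" (infixl "\<curlywedge>\<index>" 70)
  join :: "'a \<Rightarrow> 'a \<Rightarrow> 'a" (infixl "\<curlyvee>\<index>" 65)
  compl :: "'a \<Rightarrow> 'a"
  bottom :: 'a ("\<zero>\<index>")
  topp :: 'a ("\<one>\<index>")

text \<open>
  The axioms are those of the library locale \<open>abstract_boolean_algebra\<close>, relativised to the
  carrier.  The one-element algebra is not excluded.
\<close>

locale boolean_alg =
  fixes B (structure)
  assumes meet_closed: "\<lbrakk>x \<in> carrier B; y \<in> carrier B\<rbrakk> \<Longrightarrow> x \<curlywedge> y \<in> carrier B"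
    and join_closed: "\<lbrakk>x \<in> carrier B; y \<in> carrier B\<rbrakk> \<Longrightarrow> x \<curlyvee> y \<in> carrier B"
    and compl_closed: "x \<in> carrier B \<Longrightarrow> compl B x \<in> carrier B"
    and bottom_closed: "\<zero> \<in> carrier B"
    and top_closed: "\<one> \<in> carrier B"
    and meet_assoc: "\<lbrakk>x \<in> carrier B; y \<in> carrier B; z \<in> carrier B\<rbrakk>
      \<Longrightarrow> (x \<curlywedge> y) \<curlywedge> z = x \<curlywedge> (y \<curlywedge> z)"
    and join_assoc: "\<lbrakk>x \<in> carrier B; y \<in> carrier B; z \<in> carrier B\<rbrakk>
      \<Longrightarrow> (x \<curlyvee> y) \<curlyvee> z = x \<curlyvee> (y \<curlyvee> z)"
    and meet_commute: "\<lbrakk>x \<in> carrier B; y \<in> carrier B\<rbrakk> \<Longrightarrow> x \<curlywedge> y = y \<curlywedge> x"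
    and join_commute: "\<lbrakk>x \<in> carrier B; y \<in> carrier B\<rbrakk> \<Longrightarrow> x \<curlyvee> y = y \<curlyvee> x"
    and meet_join_distrib: "\<lbrakk>x \<in> carrier B; y \<in> carrier B; z \<in> carrier B\<rbrakk>
      \<Longrightarrow> x \<curlywedge> (y \<curlyvee> z) = (x \<curlywedge> y) \<curlyvee> (x \<curlywedge> z)"
    and join_meet_distrib: "\<lbrakk>x \<in> carrier B; y \<in> carrier B; z \<in> carrier B\<rbrakk>
      \<Longrightarrow> x \<curlyvee> (y \<curlywedge> z) = (x \<curlyvee> y) \<curlywedge> (x \<curlyvee> z)"
    and meet_top: "x \<in> carrier B \<Longrightarrow> x \<curlywedge> \<one> = x"
    and join_bottom: "x \<in> carrier B \<Longrightarrow> x \<curlyvee> \<zero> = x"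
    and meet_compl: "x \<in> carrier B \<Longrightarrow> x \<curlywedge> compl B x = \<zero>"
    and join_compl: "x \<in> carrier B \<Longrightarrow> x \<curlyvee> compl B x = \<one>"

record 'a dalg = "'a partial_object" +
  dmeet :: "'a \<Rightarrow> 'a \<Rightarrow> 'a" (infixl "\<sqinter>\<index>" 70)
  djoin :: "'a \<Rightarrow> 'a \<Rightarrow> 'a" (infixl "\<squnion>\<index>" 65)
  dneg :: "'a \<Rightarrow> 'a" ("\<^bold>\<not>\<index> _" [81] 80)
  dopp :: "'a \<Rightarrow> 'a" ("\<rfloor>\<index> _" [81] 80)
  dtop :: 'a ("\<top>\<index>")
  dbot :: 'a ("\<bottom>\<index>")

definition dvee :: "('a, 'm) dalg_scheme \<Rightarrow> 'a \<Rightarrow> 'a \<Rightarrow> 'a" (infixl "\<^bold>\<or>\<index>" 65)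
  where "x \<^bold>\<or>\<^bsub>D\<^esub> y = \<^bold>\<not>\<^bsub>D\<^esub> (\<^bold>\<not>\<^bsub>D\<^esub> x \<sqinter>\<^bsub>D\<^esub> \<^bold>\<not>\<^bsub>D\<^esub> y)"

definition dwedge :: "('a, 'm) dalg_scheme \<Rightarrow> 'a \<Rightarrow> 'a \<Rightarrow> 'a" (infixl "\<^bold>\<and>\<index>" 70)
  where "x \<^bold>\<and>\<^bsub>D\<^esub> y = \<rfloor>\<^bsub>D\<^esub> (\<rfloor>\<^bsub>D\<^esub> x \<squnion>\<^bsub>D\<^esub> \<rfloor>\<^bsub>D\<^esub> y)"

locale generalized_D_core_algebra =
  fixes D (structure)
  assumes dmeet_closed: "\<lbrakk>x \<in> carrier D; y \<in> carrier D\<rbrakk> \<Longrightarrow> x \<sqinter> y \<in> carrier D"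
    and djoin_closed: "\<lbrakk>x \<in> carrier D; y \<in> carrier D\<rbrakk> \<Longrightarrow> x \<squnion> y \<in> carrier D"
    and dneg_closed: "x \<in> carrier D \<Longrightarrow> \<^bold>\<not> x \<in> carrier D"
    and dopp_closed: "x \<in> carrier D \<Longrightarrow> \<rfloor> x \<in> carrier D"
    and dtop_closed: "\<top> \<in> carrier D"
    and dbot_closed: "\<bottom> \<in> carrier D"
    and dmeet_commute: "\<lbrakk>x \<in> carrier D; y \<in> carrier D\<rbrakk> \<Longrightarrow> x \<sqinter> y = y \<sqinter> x"
    and djoin_commute: "\<lbrakk>x \<in> carrier D; y \<in> carrier D\<rbrakk> \<Longrightarrow> x \<squnion> y = y \<squnion> x"
    and dneg_dmeet_self: "x \<in> carrier D \<Longrightarrow> \<^bold>\<not> (x \<sqinter> x) = \<^bold>\<not> x"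
    and dopp_djoin_self: "x \<in> carrier D \<Longrightarrow> \<rfloor> (x \<squnion> x) = \<rfloor> x"
    and dmeet_dvee_distrib: "\<lbrakk>x \<in> carrier D; y \<in> carrier D; z \<in> carrier D\<rbrakk>
      \<Longrightarrow> x \<sqinter> (y \<^bold>\<or> z) = (x \<sqinter> y) \<^bold>\<or> (x \<sqinter> z)"
    and djoin_dwedge_distrib: "\<lbrakk>x \<in> carrier D; y \<in> carrier D; z \<in> carrier D\<rbrakk>
      \<Longrightarrow> x \<squnion> (y \<^bold>\<and> z) = (x \<squnion> y) \<^bold>\<and> (x \<squnion> z)"
    and dneg_dneg_dmeet: "\<lbrakk>x \<in> carrier D; y \<in> carrier D\<rbrakk> \<Longrightarrow> \<^bold>\<not> (\<^bold>\<not> (x \<sqinter> y)) = x \<sqinter> y"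
    and dopp_dopp_djoin: "\<lbrakk>x \<in> carrier D; y \<in> carrier D\<rbrakk> \<Longrightarrow> \<rfloor> (\<rfloor> (x \<squnion> y)) = x \<squnion> y"
    and dmeet_dneg: "x \<in> carrier D \<Longrightarrow> x \<sqinter> \<^bold>\<not> x = \<bottom>"
    and djoin_dopp: "x \<in> carrier D \<Longrightarrow> x \<squnion> \<rfloor> x = \<top>"
    and dmeet_djoin_self: "x \<in> carrier D \<Longrightarrow> (x \<sqinter> x) \<squnion> (x \<sqinter> x) = (x \<squnion> x) \<sqinter> (x \<squnion> x)"

definition retr_top :: "('a, 'm) ba_scheme \<Rightarrow> 'a \<Rightarrow> 'a"
  where "retr_top P x = (if x \<in> carrier P then x else \<one>\<^bsub>P\<^esub>)"

definition retr_bot :: "('a, 'm) ba_scheme \<Rightarrow> 'a \<Rightarrow> 'a"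
  where "retr_bot Q x = (if x \<in> carrier Q then x else \<zero>\<^bsub>Q\<^esub>)"

text \<open>
  In the sum below, \<open>retr_top P\<close> is the map \<open>r\<close> and \<open>retr_bot Q\<close> the map \<open>r'\<close>.  Since both carriers
  are subsets of one type, the inclusion maps \<open>e\<close> and \<open>e'\<close> into the union are the identity and
  are not written.
\<close>

definition ba_sum :: "('a, 'm) ba_scheme \<Rightarrow> ('a, 'n) ba_scheme \<Rightarrow> 'a dalg"
  where "ba_sum P Q =
    \<lparr>carrier = carrier P \<union> carrier Q,
     dmeet = (\<lambda>x y. retr_top P x \<curlywedge>\<^bsub>P\<^esub> retr_top P y),
     djoin = (\<lambda>x y. retr_bot Q x \<curlyvee>\<^bsub>Q\<^esub> retr_bot Q y),
     dneg = (\<lambda>x. compl P (retr_top P x)),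
     dopp = (\<lambda>x. compl Q (retr_bot Q x)),
     dtop = \<one>\<^bsub>Q\<^esub>,
     dbot = \<zero>\<^bsub>P\<^esub>\<rparr>"

end

theory Submission
  imports Defs
begin

text \<open>Every law of the sum except the last uses only \<sqinter> with negation, or only
  \<squnion> with its dual negation. Results of the first kind lie in \<open>carrier P\<close>,
  where \<open>retr_top P\<close> is the identity, so such a law is a Boolean identity in
  \<open>P\<close> between retracted arguments; the second kind is the same over \<open>Q\<close>.
  De Morgan (\<open>compl_meet_compl\<close>, \<open>compl_join_compl\<close>) turns
  \<open>dvee\<close> and \<open>dwedge\<close> into the join of \<open>P\<close> and the meet of
  \<open>Q\<close>. By idempotence the last law says that the two retractions commute
  (\<open>retr_bot_retr_top\<close>); this is where the shared constants enter.\<close>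

definition dual_ba :: "('a, 'm) ba_scheme \<Rightarrow> 'a ba"
  where "dual_ba B = \<lparr>carrier = carrier B, meet = join B, join = meet B, compl = compl B,
    bottom = \<one>\<^bsub>B\<^esub>, topp = \<zero>\<^bsub>B\<^esub>\<rparr>"

lemma dual_ba_simps [simp]:
  "carrier (dual_ba B) = carrier B" "meet (dual_ba B) = join B" "join (dual_ba B) = meet B"
  "compl (dual_ba B) = compl B" "bottom (dual_ba B) = \<one>\<^bsub>B\<^esub>" "topp (dual_ba B) = \<zero>\<^bsub>B\<^esub>"
  by (simp_all add: dual_ba_def)

context boolean_alg
begin

text \<open>The axioms come in pairs exchanged by swapping meet with join and \<zero> with \<one>.
  Hence each fact proved about meets yields its counterpart for joins.\<close>

lemma boolean_alg_dual: "boolean_alg (dual_ba B)"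
  by unfold_locales
    (simp_all add: meet_closed join_closed compl_closed bottom_closed top_closed
      meet_assoc join_assoc meet_top join_bottom meet_compl join_compl
      meet_join_distrib[symmetric] join_meet_distrib[symmetric],
      simp_all add: meet_commute join_commute)

lemma meet_bottom:
  assumes "x \<in> carrier B"
  shows "x \<curlywedge> \<zero> = \<zero>"
proof -
  have "x \<curlywedge> (\<zero> \<curlyvee> compl B x) = x \<curlywedge> \<zero> \<curlyvee> x \<curlywedge> compl B x"
    using assms by (simp add: meet_join_distrib bottom_closed compl_closed)
  moreover have "\<zero> \<curlyvee> compl B x = compl B x"
    using assms by (metis join_bottom join_commute bottom_closed compl_closed)
  ultimately show ?thesis
    using assms by (simp add: meet_compl join_bottom meet_closed bottom_closed)
qed

lemma meet_idem:
  assumes "x \<in> carrier B"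
  shows "x \<curlywedge> x = x"
proof -
  have "x \<curlywedge> (x \<curlyvee> compl B x) = x \<curlywedge> x \<curlyvee> x \<curlywedge> compl B x"
    using assms by (simp add: meet_join_distrib compl_closed)
  then show ?thesis
    using assms by (simp add: join_compl meet_compl meet_top join_bottom meet_closed)
qed

text \<open>By distributivity, both \<open>compl B x\<close> and \<open>y\<close> reduce to their
  common meet.\<close>

lemma compl_unique:
  assumes x: "x \<in> carrier B" and y: "y \<in> carrier B"
    and "x \<curlywedge> y = \<zero>" and "x \<curlyvee> y = \<one>"
  shows "compl B x = y"
proof -
  note cx = compl_closed[OF x]
  have "compl B x = compl B x \<curlywedge> (x \<curlyvee> y)"
    using assms cx by (simp add: meet_top)
  also have "\<dots> = \<zero> \<curlyvee> compl B x \<curlywedge> y"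
    using x y cx by (simp add: meet_join_distrib meet_commute[of _ x] meet_compl)
  \<comment> \<open>The \<zero> that came from \<open>x \<curlywedge> compl B x\<close> is reread as
    \<open>y \<curlywedge> x\<close>, so that \<open>y\<close> can be factored out.\<close>
  also have "\<dots> = y \<curlywedge> x \<curlyvee> y \<curlywedge> compl B x"
    using assms cx by (simp add: meet_commute[of y])
  also have "\<dots> = y \<curlywedge> (x \<curlyvee> compl B x)"
    using x y cx by (simp add: meet_join_distrib)
  also have "\<dots> = y"
    using x y by (simp add: join_compl meet_top)
  finally show ?thesis .
qed

lemma compl_compl:
  assumes "x \<in> carrier B"
  shows "compl B (compl B x) = x"
  using assms
  by (intro compl_unique)
    (simp_all add: compl_closed meet_compl join_compl
      meet_commute[of "compl B x"] join_commute[of "compl B x"])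

text \<open>First half of De Morgan: each of \<open>x\<close> and \<open>y\<close> annihilates the
  meet of the complements, hence so does their join.\<close>

lemma meet_join_compl_meet_compl:
  assumes x: "x \<in> carrier B" and y: "y \<in> carrier B"
  shows "(x \<curlyvee> y) \<curlywedge> (compl B x \<curlywedge> compl B y) = \<zero>"
proof -
  let ?c = "compl B x \<curlywedge> compl B y"
  note cx = compl_closed[OF x] and cy = compl_closed[OF y]
  have "x \<curlywedge> ?c = \<zero>"
    using x cx cy
    by (metis meet_assoc meet_compl meet_bottom meet_commute bottom_closed)
  moreover have "y \<curlywedge> ?c = \<zero>"
    using y cx cy
    by (metis meet_assoc meet_compl meet_bottom meet_commute)
  moreover have "(x \<curlyvee> y) \<curlywedge> ?c = x \<curlywedge> ?c \<curlyvee> y \<curlywedge> ?c"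
    using x y cx cy
    by (simp add: meet_commute[of _ ?c] meet_join_distrib meet_closed join_closed)
  ultimately show ?thesis
    by (simp add: join_bottom bottom_closed)
qed

lemma join_join_compl_meet_compl:
  assumes x: "x \<in> carrier B" and y: "y \<in> carrier B"
  shows "(x \<curlyvee> y) \<curlyvee> (compl B x \<curlywedge> compl B y) = \<one>"
proof -
  interpret dual: boolean_alg "dual_ba B"
    by (rule boolean_alg_dual)
  note cx = compl_closed[OF x] and cy = compl_closed[OF y]
  show ?thesis
    \<comment> \<open>At the complements, the dual statement contains double complements; removing
      them leaves the goal up to commutativity.\<close>
    using dual.meet_join_compl_meet_compl[of "compl B x" "compl B y"] x y cx cy
    by (simp add: compl_compl join_commute meet_closed join_closed)
qed

lemma compl_meet_compl:
  assumes "x \<in> carrier B" and "y \<in> carrier B"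
  shows "compl B (compl B x \<curlywedge> compl B y) = x \<curlyvee> y"
proof -
  have "compl B (x \<curlyvee> y) = compl B x \<curlywedge> compl B y"
    using assms
    by (intro compl_unique meet_join_compl_meet_compl join_join_compl_meet_compl
        join_closed meet_closed compl_closed)
  then show ?thesis
    using assms by (metis compl_compl join_closed)
qed

lemma join_idem: "x \<in> carrier B \<Longrightarrow> x \<curlyvee> x = x"
  using boolean_alg.meet_idem[OF boolean_alg_dual, of x] by simp

lemma compl_join_compl:
  "\<lbrakk>x \<in> carrier B; y \<in> carrier B\<rbrakk> \<Longrightarrow> compl B (compl B x \<curlyvee> compl B y) = x \<curlywedge> y"
  using boolean_alg.compl_meet_compl[OF boolean_alg_dual, of x y] by simp

end

lemma retr_top_id [simp]: "x \<in> carrier P \<Longrightarrow> retr_top P x = x"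
  by (simp add: retr_top_def)

lemma retr_bot_id [simp]: "x \<in> carrier Q \<Longrightarrow> retr_bot Q x = x"
  by (simp add: retr_bot_def)

lemma (in boolean_alg) retr_top_closed: "retr_top B x \<in> carrier B"
  by (simp add: retr_top_def top_closed)

lemma (in boolean_alg) retr_bot_closed: "retr_bot B x \<in> carrier B"
  by (simp add: retr_bot_def bottom_closed)

text \<open>Points of both carriers are fixed by both maps. A point only in \<open>P\<close> goes to
  \<zero> of \<open>Q\<close> either way, as that constant lies in \<open>P\<close>; a point only in
  \<open>Q\<close> goes to \<one> of \<open>P\<close>, which lies in \<open>Q\<close>.\<close>

lemma retr_bot_retr_top:
  assumes "x \<in> carrier P \<union> carrier Q" and "\<one>\<^bsub>P\<^esub> \<in> carrier Q" and "\<zero>\<^bsub>Q\<^esub> \<in> carrier P"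
  shows "retr_bot Q (retr_top P x) = retr_top P (retr_bot Q x)"
  using assms by (auto simp: retr_top_def retr_bot_def)

theorem theorem4p9:
  fixes P :: "('a, 'm) ba_scheme" and Q :: "('a, 'n) ba_scheme"
  assumes "boolean_alg P" and "boolean_alg Q"
    and "{\<one>\<^bsub>P\<^esub>, \<zero>\<^bsub>Q\<^esub>} \<subseteq> carrier P \<inter> carrier Q"
  shows "generalized_D_core_algebra (ba_sum P Q)"
proof -
  interpret P: boolean_alg P by fact
  interpret Q: boolean_alg Q by fact
  note closed = P.meet_closed P.join_closed P.compl_closed P.bottom_closed P.retr_top_closed
    Q.meet_closed Q.join_closed Q.compl_closed Q.top_closed Q.retr_bot_closed
  show ?thesis
    \<comment> \<open>Closure removes every retraction applied to a result in its own algebra;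
      commuting retractions settle the law that mixes both algebras.\<close>
    by unfold_locales
      (use assms(3) in \<open>simp_all add: ba_sum_def dvee_def dwedge_def closed
        P.meet_commute Q.join_commute P.meet_idem Q.join_idem P.compl_compl Q.compl_compl
        P.compl_meet_compl Q.compl_join_compl P.meet_join_distrib Q.join_meet_distrib
        P.meet_compl Q.join_compl\<close>,
        auto simp: retr_bot_retr_top)
qed

end
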